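(* The closed word problem for meadows is decidable; that is, there is an algorithm which, given two closed terms $s,t$ over the signature $(0,1,-,{}^{-1},+,\cdot)$ of meadows, decides whether $\mathit{Md}\vdash s=t$.
   Context: The signature of meadows has constants $0,1$, unary operations $-$ and ${}^{-1}$, and binary operations $+$ and $\cdot$. $\mathit{Md}$ is the set of equations consisting of the axioms of commutative rings with multiplicative identity, $(x+y)+z=x+(y+z)$, $x+y=y+x$, $x+0=x$, $x+(-x)=0$, $(x\cdot y)\cdot z=x\cdot(y\cdot z)$, $x\cdot y=y\cdot x$, $x\cdot 1=x$, $x\cdot(y+z)=x\cdot y+x\cdot z$, together with $(x^{-1})^{-1}=x$ and $x\cdot(x\cdot x^{-1})=x$. A meadow is a model of $\mathit{Md}$. $\mathit{Md}\vdash s=t$ means that $s=t$ is derivable from $\mathit{Md}$ in equational logic (equivalently, $s=t$ holds in every meadow). A closed term is a term without variables. *)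

theory Defs
  imports Main "HOL-Library.Nat_Bijection"
begin

section \<open>Meadow terms and equational logic\<close>

datatype (vars: 'v) mterm =
    Var 'v
  | Zero
  | One
  | Neg "'v mterm"
  | Inv "'v mterm"
  | Add "'v mterm" "'v mterm" (infixl "\<oplus>" 65)
  | Mul "'v mterm" "'v mterm" (infixl "\<odot>" 70)

definition closed_term :: "'v mterm \<Rightarrow> bool" where
  "closed_term t \<longleftrightarrow> vars t = {}"

primrec subst :: "('v \<Rightarrow> 'v mterm) \<Rightarrow> 'v mterm \<Rightarrow> 'v mterm" where
  "subst \<sigma> (Var v) = \<sigma> v"
| "subst \<sigma> Zero = Zero"
| "subst \<sigma> One = One"
| "subst \<sigma> (Neg t) = Neg (subst \<sigma> t)"
| "subst \<sigma> (Inv t) = Inv (subst \<sigma> t)"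
| "subst \<sigma> (s \<oplus> t) = subst \<sigma> s \<oplus> subst \<sigma> t"
| "subst \<sigma> (s \<odot> t) = subst \<sigma> s \<odot> subst \<sigma> t"

inductive derivable :: "('v mterm \<times> 'v mterm) set \<Rightarrow> 'v mterm \<Rightarrow> 'v mterm \<Rightarrow> bool"
  for E :: "('v mterm \<times> 'v mterm) set" where
  ax: "(s, t) \<in> E \<Longrightarrow> derivable E s t"
| refl: "derivable E t t"
| sym: "derivable E s t \<Longrightarrow> derivable E t s"
| trans: "derivable E s t \<Longrightarrow> derivable E t u \<Longrightarrow> derivable E s u"
| inst: "derivable E s t \<Longrightarrow> derivable E (subst \<sigma> s) (subst \<sigma> t)"
| neg: "derivable E s t \<Longrightarrow> derivable E (Neg s) (Neg t)"
| inv: "derivable E s t \<Longrightarrow> derivable E (Inv s) (Inv t)"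
| add: "derivable E s t \<Longrightarrow> derivable E s' t' \<Longrightarrow> derivable E (s \<oplus> s') (t \<oplus> t')"
| mul: "derivable E s t \<Longrightarrow> derivable E s' t' \<Longrightarrow> derivable E (s \<odot> s') (t \<odot> t')"

definition Md :: "(nat mterm \<times> nat mterm) set" where
  "Md = (let x = Var 0; y = Var 1; z = Var 2 in
    { ((x \<oplus> y) \<oplus> z, x \<oplus> (y \<oplus> z)),
      (x \<oplus> y, y \<oplus> x),
      (x \<oplus> Zero, x),
      (x \<oplus> Neg x, Zero),
      ((x \<odot> y) \<odot> z, x \<odot> (y \<odot> z)),
      (x \<odot> y, y \<odot> x),
      (x \<odot> One, x),
      (x \<odot> (y \<oplus> z), x \<odot> y \<oplus> x \<odot> z),
      (Inv (Inv x), x),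
      (x \<odot> (x \<odot> Inv x), x) })"

text \<open>An explicit Goedel numbering, so that the numbering itself is effective: the number of a
  compound term is computed from the numbers of its immediate subterms by the Cantor pairing
  function \<open>prod_encode\<close>, and the top symbol and the subterm numbers can be read back off it.
  It is in fact a bijection onto the natural numbers.\<close>

primrec code :: "nat mterm \<Rightarrow> nat" where
  "code Zero = 0"
| "code One = 1"
| "code (Var n) = 5 * n + 2"
| "code (Neg t) = 5 * code t + 3"
| "code (Inv t) = 5 * code t + 4"
| "code (s \<oplus> t) = 5 * prod_encode (code s, code t) + 5"
| "code (s \<odot> t) = 5 * prod_encode (code s, code t) + 6"

lemma bij_code: "bij code"
proof (rule bijI)
  have "code s = code t \<Longrightarrow> s = t" for s t
  proof (induction s arbitrary: t)
    case (Var v) then show ?case by (cases t) (simp_all, presburger+)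
  next
    case Zero then show ?case by (cases t) simp_all
  next
    case One then show ?case by (cases t) simp_all
  next
    case (Neg s) then show ?case by (cases t) (simp_all, presburger+)
  next
    case (Inv s) then show ?case by (cases t) (simp_all, presburger+)
  next
    case (Add s1 s2) then show ?case by (cases t) (simp_all, presburger+)
  next
    case (Mul s1 s2) then show ?case by (cases t) (simp_all, presburger+)
  qed
  then show "inj code" by (rule injI)
next
  have "\<exists>t. code t = n" for n
  proof (induction n rule: less_induct)
    case (less n)
    define m where "m = n div 5"
    define p where "p = prod_decode (m - 1)"
    have p: "prod_encode (fst p, snd p) = m - 1" by (simp add: p_def)
    have b: "fst p \<le> m - 1" "snd p \<le> m - 1"
      using le_prod_encode_1[of "fst p" "snd p"] le_prod_encode_2[of "snd p" "fst p"] p by simp_all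
    have "n = 0 \<or> n = 1 \<or> n = 5 * m + 2 \<or> n = 5 * m + 3 \<or> n = 5 * m + 4 \<or>
        m > 0 \<and> n = 5 * m \<or> m > 0 \<and> n = 5 * m + 1"
      unfolding m_def by presburger
    then consider "n = 0" | "n = 1" | "n = 5 * m + 2" | "n = 5 * m + 3" | "n = 5 * m + 4"
      | "m > 0" "n = 5 * m" | "m > 0" "n = 5 * m + 1"
      by blast
    then show ?case
    proof cases
      case 1 then show ?thesis by (metis code.simps(1))
    next
      case 2 then show ?thesis by (metis code.simps(2))
    next
      case 3 then show ?thesis by (metis code.simps(3))
    next
      case 4
      then obtain t where "code t = m" using less[of m] by auto
      then show ?thesis using 4 by (metis code.simps(4))
    next
      case 5
      then obtain t where "code t = m" using less[of m] by auto
      then show ?thesis using 5 by (metis code.simps(5))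
    next
      case 6
      then have "fst p < n" "snd p < n" using b by linarith+
      then obtain s t where "code s = fst p" "code t = snd p"
        using less[of "fst p"] less[of "snd p"] by blast
      then have "code (s \<oplus> t) = n" using p 6 by simp
      then show ?thesis ..
    next
      case 7
      then have "fst p < n" "snd p < n" using b by linarith+
      then obtain s t where "code s = fst p" "code t = snd p"
        using less[of "fst p"] less[of "snd p"] by blast
      then have "code (s \<odot> t) = n" using p 7 by simp
      then show ?thesis ..
    qed
  qed
  then show "surj code" by (metis surjI)
qed

section \<open>Partial recursive functions\<close>

text \<open>Kleene's \<open>\<mu>\<close>-recursive functions, as programs with a partial semantics on argument lists.
  Arities are not part of the syntax: a program denotes one function for each
  argument length, and \<open>None\<close> means divergence or an unsuitable number of arguments.\<close>

datatype recf =
    RZero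
  | RSucc
  | RProj nat
  | RComp recf "recf list"
  | RPrec recf recf
  | RMu recf

text \<open>\<open>those\<close> makes composition strict: it is undefined as soon as one inner value is.
  Likewise minimization is defined only if the search meets no undefined value
  before its first zero.\<close>

fun eval :: "recf \<Rightarrow> nat list \<Rightarrow> nat option" where
  "eval RZero xs = Some 0"
| "eval RSucc xs = (case xs of [x] \<Rightarrow> Some (Suc x) | _ \<Rightarrow> None)"
| "eval (RProj i) xs = (if i < length xs then Some (xs ! i) else None)"
| "eval (RComp f gs) xs = Option.bind (those (map (\<lambda>g. eval g xs) gs)) (\<lambda>ys. eval f ys)"
| "eval (RPrec f g) xs = (case xs of
      [] \<Rightarrow> None
    | n # ys \<Rightarrow> rec_nat (eval f ys) (\<lambda>k r. Option.bind r (\<lambda>y. eval g (k # y # ys))) n)"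
| "eval (RMu f) xs =
    (if \<exists>n. eval f (n # xs) = Some 0 \<and> (\<forall>m<n. \<exists>y. eval f (m # xs) = Some (Suc y))
     then Some (LEAST n. eval f (n # xs) = Some 0) else None)"

end

theory Submission
  imports "HOL-Number_Theory.Residues" Defs
begin

text \<open>
  Every closed equation \<open>s = t\<close> amounts to \<open>u = 0\<close> for \<open>u = s - t\<close>, so it suffices to decide
  provability of \<open>u = 0\<close>. Two observations make this a single divisibility test.

  First, a closed term can be evaluated modulo every prime divisor of \<open>M\<close> at once, provided that
  \<open>p - 1\<close> divides \<open>M\<close> for each such prime \<open>p\<close>: by Fermat's little theorem the meadow inverse of
  \<open>x\<close> in the prime field of order \<open>p\<close>, with \<open>0\<close> inverse to itself, is \<open>x ^ (M - 1)\<close>, whatever \<open>p\<close>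
  is. Factorials have this property. The resulting natural number \<open>residue M \<rho> u\<close> respects
  provable equality modulo all primes \<open>p\<close> dividing \<open>M\<close> (\<open>residue_sound\<close>), so a provable \<open>u = 0\<close> makes
  it divisible by all of them, that is, makes \<open>M\<close> divide its \<open>M\<close>-th power.

  Second, the converse holds once \<open>M\<close> is large. In a meadow \<open>m * minv m\<close> is idempotent for each
  integer \<open>m\<close>, and splits the ring into a part where \<open>m\<close> is invertible and one where \<open>m\<close> is zero. Where
  \<open>M\<close> is zero, \<open>u\<close> agrees with its residue (\<open>mval_eq_residue\<close>), which vanishes there when the test
  succeeds, since meadows have no nilpotent elements. Where the integers up to a bound \<open>h\<close> computed
  from \<open>u\<close> are invertible, \<open>u\<close> agrees with a fraction \<open>a / b\<close> with entries bounded by \<open>h\<close>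
  (\<open>mval_fraction\<close>), the value of \<open>u\<close> among the rational numbers. This covers the part where \<open>M\<close> is
  invertible, as soon as \<open>M\<close> is a multiple of all these integers; it remains to see \<open>a = 0\<close>. For this
  let \<open>q = h! + 1\<close> and choose \<open>M\<close> a multiple of \<open>q\<close>. The part of the free meadow where \<open>q\<close> is zero
  is nontrivial, because it maps onto the prime fields of the prime factors of \<open>q\<close>. There both
  descriptions of \<open>u\<close> apply, as \<open>M\<close> is zero and all integers up to \<open>h\<close> divide \<open>h! = -1\<close>. Hence
  \<open>a = 0\<close> on that part, and \<open>a\<close> is either zero or invertible there.

  With \<open>h = 2 ^ code u\<close> and \<open>M = (h! + 1)!\<close> the test is a primitive recursive function of the
  code of \<open>u\<close>; the only recursion beyond ordinary primitive recursion is the course-of-values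
  recursion that evaluates the residue along the structure of \<open>u\<close>.\<close>

section \<open>Total recursive functions\<close>

definition total_rec :: "nat \<Rightarrow> (nat list \<Rightarrow> nat) \<Rightarrow> bool" where
  "total_rec k F \<longleftrightarrow> (\<exists>f. \<forall>xs. length xs = k \<longrightarrow> eval f xs = Some (F xs))"

lemma total_rec_cong:
  "total_rec k F \<Longrightarrow> (\<And>xs. length xs = k \<Longrightarrow> F xs = G xs) \<Longrightarrow> total_rec k G"
  unfolding total_rec_def by metis

lemma total_rec_proj: "i < k \<Longrightarrow> total_rec k (\<lambda>xs. xs ! i)"
  unfolding total_rec_def by (rule exI[of _ "RProj i"]) simp

lemma total_rec_comp:
  assumes G: "total_rec (length Fs) G" and Fs: "\<forall>F \<in> set Fs. total_rec k F"
  shows "total_rec k (\<lambda>xs. G (map (\<lambda>F. F xs) Fs))"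
proof -
  have "\<exists>gs. \<forall>xs. length xs = k \<longrightarrow> those (map (\<lambda>g. eval g xs) gs) = Some (map (\<lambda>F. F xs) Fs)"
    using Fs
  proof (induction Fs)
    case Nil
    show ?case by (rule exI[of _ "[]"]) simp
  next
    case (Cons F Fs)
    obtain gs where "\<forall>xs. length xs = k \<longrightarrow> those (map (\<lambda>g. eval g xs) gs) = Some (map (\<lambda>F. F xs) Fs)"
      using Cons by auto
    moreover obtain f where "\<forall>xs. length xs = k \<longrightarrow> eval f xs = Some (F xs)"
      using Cons.prems by (auto simp: total_rec_def)
    ultimately show ?case by (intro exI[of _ "f # gs"]) simp
  qed
  then obtain gs where gs:
    "\<forall>xs. length xs = k \<longrightarrow> those (map (\<lambda>g. eval g xs) gs) = Some (map (\<lambda>F. F xs) Fs)" ..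
  obtain g where "\<forall>xs. length xs = length Fs \<longrightarrow> eval g xs = Some (G xs)"
    using G by (auto simp: total_rec_def)
  with gs show ?thesis
    unfolding total_rec_def by (intro exI[of _ "RComp g gs"]) simp
qed

lemma total_rec_comp1:
  "total_rec 1 (\<lambda>ys. g (ys ! 0)) \<Longrightarrow> total_rec k F \<Longrightarrow> total_rec k (\<lambda>xs. g (F xs))"
  using total_rec_comp[of "[F]" "\<lambda>ys. g (ys ! 0)" k] by simp

lemma total_rec_comp2:
  "total_rec 2 (\<lambda>ys. g (ys ! 0) (ys ! 1)) \<Longrightarrow> total_rec k F \<Longrightarrow> total_rec k G \<Longrightarrow>
     total_rec k (\<lambda>xs. g (F xs) (G xs))"
  using total_rec_comp[of "[F, G]" "\<lambda>ys. g (ys ! 0) (ys ! 1)" k] by (simp add: numeral_2_eq_2)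

lemma total_rec_Suc: "total_rec k F \<Longrightarrow> total_rec k (\<lambda>xs. Suc (F xs))"
proof (erule total_rec_comp1[rotated])
  show "total_rec 1 (\<lambda>ys. Suc (ys ! 0))"
    unfolding total_rec_def by (rule exI[of _ RSucc]) (auto simp: length_Suc_conv)
qed

lemma total_rec_const: "total_rec k (\<lambda>xs. c)"
proof (induction c)
  case 0
  show ?case unfolding total_rec_def by (rule exI[of _ RZero]) simp
qed (rule total_rec_Suc)

text \<open>The program for primitive recursion passes the parameters unchanged and recurses on the first
  argument only. Feeding it the list of all projections behind \<open>N\<close> turns this into recursion up to
  an arbitrary \<open>N xs\<close> with all of \<open>xs\<close> as parameters, which is the form needed to compose.\<close>

lemma total_rec_rec_nat:
  assumes F: "total_rec k F" and G: "total_rec (Suc (Suc k)) G" and N: "total_rec k N"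
  shows "total_rec k (\<lambda>xs. rec_nat (F xs) (\<lambda>m r. G (m # r # xs)) (N xs))"
proof -
  obtain f where f: "\<forall>xs. length xs = k \<longrightarrow> eval f xs = Some (F xs)"
    using F by (auto simp: total_rec_def)
  obtain g where g: "\<forall>xs. length xs = Suc (Suc k) \<longrightarrow> eval g xs = Some (G xs)"
    using G by (auto simp: total_rec_def)
  have "eval (RPrec f g) (n # xs) = Some (rec_nat (F xs) (\<lambda>m r. G (m # r # xs)) n)"
    if "length xs = k" for n xs
    using that f g by (induction n) auto
  then have "total_rec (Suc k) (\<lambda>ys. rec_nat (F (tl ys)) (\<lambda>m r. G (m # r # tl ys)) (hd ys))"
    unfolding total_rec_def
    by (intro exI[of _ "RPrec f g"]) (auto simp: length_Suc_conv simp del: eval.simps)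
  moreover have args: "map (\<lambda>F. F xs) (map (\<lambda>i xs. xs ! i) [0..<k]) = xs" if "length xs = k" for xs :: "nat list"
    using that by (auto simp: comp_def map_nth)
  moreover have "\<forall>P \<in> set (N # map (\<lambda>i xs. xs ! i) [0..<k]). total_rec k P"
    using N by (auto intro: total_rec_proj)
  ultimately have "total_rec k (\<lambda>xs. (\<lambda>ys. rec_nat (F (tl ys)) (\<lambda>m r. G (m # r # tl ys)) (hd ys))
      (map (\<lambda>P. P xs) (N # map (\<lambda>i xs. xs ! i) [0..<k])))"
    by (intro total_rec_comp) simp_all
  then show ?thesis
    by (rule total_rec_cong) (simp add: args del: map_map)
qed

text \<open>Closure properties whose conclusions are syntax directed, so that an explicitly written
  function is seen to be recursive by repeated introduction.\<close>

named_theorems recursive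

lemmas [recursive] = total_rec_proj total_rec_Suc total_rec_const

lemma total_rec_add [recursive]:
  assumes "total_rec k F" "total_rec k G"
  shows "total_rec k (\<lambda>xs. F xs + G xs)"
proof -
  have "rec_nat a (\<lambda>m. Suc) b = a + b" for a b :: nat by (induction b) auto
  then show ?thesis
    using total_rec_rec_nat[of k F "\<lambda>ys. Suc (ys ! 1)" G] assms by (simp add: recursive)
qed

lemma total_rec_mult [recursive]:
  assumes "total_rec k F" "total_rec k G"
  shows "total_rec k (\<lambda>xs. F xs * G xs)"
proof (rule total_rec_comp2[OF _ assms])
  have "rec_nat 0 (\<lambda>m r. r + a) b = a * b" for a b :: nat by (induction b) auto
  then show "total_rec 2 (\<lambda>ys. ys ! 0 * ys ! 1)"
    using total_rec_rec_nat[of 2 "\<lambda>ys. 0" "\<lambda>ys. ys ! 1 + ys ! 2" "\<lambda>ys. ys ! 1"]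
    by (simp add: recursive)
qed

lemma total_rec_power [recursive]:
  assumes "total_rec k F" "total_rec k G"
  shows "total_rec k (\<lambda>xs. F xs ^ G xs)"
proof (rule total_rec_comp2[OF _ assms])
  have "rec_nat 1 (\<lambda>m r. r * a) b = a ^ b" for a b :: nat by (induction b) auto
  then show "total_rec 2 (\<lambda>ys. ys ! 0 ^ ys ! 1)"
    using total_rec_rec_nat[of 2 "\<lambda>ys. 1" "\<lambda>ys. ys ! 1 * ys ! 2" "\<lambda>ys. ys ! 1"]
    by (simp add: recursive)
qed

lemma total_rec_fact [recursive]:
  assumes "total_rec k F"
  shows "total_rec k (\<lambda>xs. fact (F xs))"
proof -
  have "rec_nat 1 (\<lambda>m r. Suc m * r) b = fact b" for b :: nat by (induction b) auto
  then show ?thesis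
    using total_rec_rec_nat[of k "\<lambda>ys. 1" "\<lambda>ys. Suc (ys ! 0) * ys ! 1" F] assms
    by (simp add: recursive)
qed

lemma total_rec_diff [recursive]:
  assumes "total_rec k F" "total_rec k G"
  shows "total_rec k (\<lambda>xs. F xs - G xs)"
proof -
  have "rec_nat 0 (\<lambda>m r. m) b = b - 1" for b :: nat by (induction b) auto
  then have "total_rec 1 (\<lambda>ys. ys ! 0 - 1)"
    using total_rec_rec_nat[of 1 "\<lambda>ys. 0" "\<lambda>ys. ys ! 0" "\<lambda>ys. ys ! 0"] by (simp add: recursive)
  from total_rec_comp1[OF this, of "Suc (Suc k)" "\<lambda>ys. ys ! 1"]
  have "total_rec (Suc (Suc k)) (\<lambda>ys. ys ! 1 - 1)"
    by (simp add: recursive)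
  moreover have "rec_nat a (\<lambda>m r. r - 1) b = a - b" for a b :: nat by (induction b) auto
  ultimately show ?thesis
    using total_rec_rec_nat[of k F "\<lambda>ys. ys ! 1 - 1" G] assms by simp
qed

lemma total_rec_if_eq [recursive]:
  assumes "total_rec k A" "total_rec k B" "total_rec k F" "total_rec k G"
  shows "total_rec k (\<lambda>xs. if A xs = B xs then F xs else G xs)"
proof -
  \<comment> \<open>the indicator of zero, as \<open>0 ^ 0 = 1\<close>\<close>
  define z where "z n = (0::nat) ^ n" for n :: nat
  have "total_rec k (\<lambda>xs. z (A xs - B xs + (B xs - A xs)) * F xs +
      (1 - z (A xs - B xs + (B xs - A xs))) * G xs)"
    unfolding z_def by (intro recursive assms)
  then show ?thesis
    by (rule total_rec_cong) (auto simp: z_def power_0_left)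
qed

lemma total_rec_if_le [recursive]:
  assumes "total_rec k A" "total_rec k B" "total_rec k F" "total_rec k G"
  shows "total_rec k (\<lambda>xs. if A xs \<le> B xs then F xs else G xs)"
  using total_rec_if_eq[of k "\<lambda>xs. A xs - B xs" "\<lambda>xs. 0" F G] assms by (simp add: recursive)

lemma total_rec_mod [recursive]:
  assumes "total_rec k F" "total_rec k G"
  shows "total_rec k (\<lambda>xs. F xs mod G xs)"
proof (rule total_rec_comp2[OF _ assms])
  have "rec_nat 0 (\<lambda>m r. if Suc r = b then 0 else Suc r) a = a mod b" for a b :: nat
    by (induction a) (auto simp: mod_Suc)
  then show "total_rec 2 (\<lambda>ys. ys ! 0 mod ys ! 1)"
    using total_rec_rec_nat[of 2 "\<lambda>ys. 0" "\<lambda>ys. if Suc (ys ! 1) = ys ! 3 then 0 else Suc (ys ! 1)"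
        "\<lambda>ys. ys ! 0"]
    by (simp add: recursive numeral_3_eq_3 cong: if_cong)
qed

lemma total_rec_div [recursive]:
  assumes "total_rec k F" "total_rec k G"
  shows "total_rec k (\<lambda>xs. F xs div G xs)"
proof (rule total_rec_comp2[OF _ assms])
  have "rec_nat 0 (\<lambda>m r. if Suc m mod b = 0 then Suc r else r) a = a div b" for a b :: nat
    by (induction a) (auto simp: div_Suc)
  then show "total_rec 2 (\<lambda>ys. ys ! 0 div ys ! 1)"
    using total_rec_rec_nat[of 2 "\<lambda>ys. 0"
        "\<lambda>ys. if Suc (ys ! 0) mod ys ! 3 = 0 then Suc (ys ! 1) else ys ! 1" "\<lambda>ys. ys ! 0"]
    by (simp add: recursive numeral_3_eq_3 cong: if_cong)
qed

lemma total_rec_triangle [recursive]: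
  assumes "total_rec k F"
  shows "total_rec k (\<lambda>xs. triangle (F xs))"
  unfolding triangle_def by (intro recursive assms)

lemma total_rec_prod_encode [recursive]:
  assumes "total_rec k F" "total_rec k G"
  shows "total_rec k (\<lambda>xs. prod_encode (F xs, G xs))"
  unfolding prod_encode_def split by (intro recursive assms)

text \<open>The index of the antidiagonal on which \<open>z\<close> lies in Cantor's enumeration, that is, the sum of
  the two components of \<open>prod_decode z\<close>. It grows by at most one from \<open>z\<close> to \<open>Suc z\<close>, which
  makes decoding primitive recursive.\<close>

definition diag :: "nat \<Rightarrow> nat" where
  "diag z = rec_nat 0 (\<lambda>m d. if triangle (Suc d) \<le> Suc m then Suc d else d) z"

lemma triangle_diag: "triangle (diag z) \<le> z" "z < triangle (Suc (diag z))"
proof -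
  have "triangle (diag z) \<le> z \<and> z < triangle (Suc (diag z))"
    by (induction z) (auto simp: diag_def)
  then show "triangle (diag z) \<le> z" "z < triangle (Suc (diag z))" by auto
qed

lemma prod_decode_diag: "prod_decode z = (z - triangle (diag z), diag z - (z - triangle (diag z)))"
proof -
  have "prod_encode (z - triangle (diag z), diag z - (z - triangle (diag z))) = z"
    using triangle_diag[of z] by (simp add: prod_encode_def)
  then show ?thesis by (metis prod_encode_inverse)
qed

lemma total_rec_diag [recursive]:
  assumes "total_rec k F"
  shows "total_rec k (\<lambda>xs. diag (F xs))"
  unfolding diag_def
  using total_rec_rec_nat[of k "\<lambda>ys. 0"
      "\<lambda>ys. if triangle (Suc (ys ! 1)) \<le> Suc (ys ! 0) then Suc (ys ! 1) else ys ! 1" F] assms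
  by (simp add: recursive cong: if_cong del: triangle_Suc)

lemma total_rec_fst_prod_decode [recursive]:
  "total_rec k F \<Longrightarrow> total_rec k (\<lambda>xs. fst (prod_decode (F xs)))"
  unfolding prod_decode_diag fst_conv by (intro recursive)

lemma total_rec_snd_prod_decode [recursive]:
  "total_rec k F \<Longrightarrow> total_rec k (\<lambda>xs. snd (prod_decode (F xs)))"
  unfolding prod_decode_diag snd_conv by (intro recursive)

text \<open>The list of values of \<open>v\<close> below \<open>n\<close>, the latest first, coded by iterated pairing, so that
  \<open>v i\<close> is found after dropping \<open>n - Suc i\<close> entries.\<close>

primrec history :: "(nat \<Rightarrow> nat) \<Rightarrow> nat \<Rightarrow> nat" where
  "history v 0 = 0"
| "history v (Suc n) = prod_encode (v n, history v n)"

definition recall :: "nat \<Rightarrow> nat \<Rightarrow> nat \<Rightarrow> nat" where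
  "recall n H i = fst (prod_decode (rec_nat H (\<lambda>_ z. snd (prod_decode z)) (n - Suc i)))"

lemma recall_history:
  assumes "i < n"
  shows "recall n (history v n) i = v i"
proof -
  have drop: "rec_nat (history v n) (\<lambda>_ z. snd (prod_decode z)) j = history v (n - j)" if "j \<le> n" for j
    using that
  proof (induction j)
    case (Suc j)
    then have "n - j = Suc (n - Suc j)" by simp
    with Suc show ?case by simp
  qed simp
  have "n - (n - Suc i) = Suc i" using assms by simp
  then show ?thesis using drop[of "n - Suc i"] by (simp add: recall_def)
qed

lemma total_rec_recall [recursive]:
  assumes "total_rec k N" "total_rec k H" "total_rec k I"
  shows "total_rec k (\<lambda>xs. recall (N xs) (H xs) (I xs))"
proof -
  have "total_rec k (\<lambda>xs. N xs - Suc (I xs))" by (intro recursive assms)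
  from total_rec_rec_nat[OF assms(2) _ this, of "\<lambda>ys. snd (prod_decode (ys ! 1))"]
  have "total_rec k (\<lambda>xs. rec_nat (H xs) (\<lambda>_ z. snd (prod_decode z)) (N xs - Suc (I xs)))"
    by (simp add: recursive)
  then show ?thesis unfolding recall_def by (intro recursive)
qed

text \<open>Since \<open>history\<close> extends by one application of the step function, it is itself primitive
  recursive, and \<open>v a n\<close> is the head of the history of length \<open>Suc n\<close>.\<close>

lemma total_rec_course_of_values:
  assumes G: "total_rec 3 (\<lambda>ys. G (ys ! 0) (ys ! 1) (ys ! 2))"
    and v: "\<And>a n. v a n = G a n (history (v a) n)"
    and A: "total_rec k A" and N: "total_rec k N"
  shows "total_rec k (\<lambda>xs. v (A xs) (N xs))"
proof (rule total_rec_comp2[OF _ A N])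
  have hist: "rec_nat 0 (\<lambda>m r. prod_encode (G a m r, r)) n = history (v a) n" for a n
    by (induction n) (auto simp: v[symmetric])
  have "total_rec 4 (\<lambda>ys. G (ys ! 2) (ys ! 0) (ys ! 1))"
    using total_rec_comp[of "[\<lambda>ys. ys ! 2, \<lambda>ys. ys ! 0, \<lambda>ys. ys ! 1]" "\<lambda>ys. G (ys ! 0) (ys ! 1) (ys ! 2)" 4] G
    by (simp add: recursive numeral_3_eq_3 numeral_2_eq_2)
  then have "total_rec (Suc (Suc 2)) (\<lambda>ys. prod_encode (G (ys ! 2) (ys ! 0) (ys ! 1), ys ! 1))"
    by (intro recursive) simp_all
  from total_rec_rec_nat[OF _ this, of "\<lambda>ys. 0" "\<lambda>ys. Suc (ys ! 1)"]
  have "total_rec 2 (\<lambda>ys. history (v (ys ! 0)) (Suc (ys ! 1)))"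
    by (simp add: recursive hist v[symmetric])
  from total_rec_fst_prod_decode[OF this]
  show "total_rec 2 (\<lambda>ys. v (ys ! 0) (ys ! 1))" by simp
qed

section \<open>Simultaneous evaluation in prime fields\<close>

text \<open>Negation and inversion are expressed by multiplication and powers, so that the value is a natural
  number that represents the value of the term in all prime fields at once whose characteristic \<open>p\<close>
  divides \<open>M\<close> and satisfies \<open>(p - 1) dvd M\<close>. Then \<open>M - 1\<close> is \<open>-1\<close> modulo \<open>p\<close>, and also modulo the
  order \<open>p - 1\<close> of the multiplicative group.\<close>

primrec residue :: "nat \<Rightarrow> (nat \<Rightarrow> nat) \<Rightarrow> nat mterm \<Rightarrow> nat" where
  "residue M \<rho> (Var x) = \<rho> x"
| "residue M \<rho> Zero = 0"
| "residue M \<rho> One = 1"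
| "residue M \<rho> (Neg t) = (M - 1) * residue M \<rho> t"
| "residue M \<rho> (Inv t) = residue M \<rho> t ^ (M - 1)"
| "residue M \<rho> (Add s t) = residue M \<rho> s + residue M \<rho> t"
| "residue M \<rho> (Mul s t) = residue M \<rho> s * residue M \<rho> t"

lemma residue_subst: "residue M \<rho> (subst \<sigma> t) = residue M (\<lambda>x. residue M \<rho> (\<sigma> x)) t"
  by (induction t) simp_all

lemma fermat_power_cong:
  fixes p x :: nat
  assumes "prime p" "(p - 1) dvd k"
  shows "[x ^ Suc k = x] (mod p)"
proof (cases "p dvd x")
  case True
  then show ?thesis by (simp add: cong_def)
next
  case False
  obtain j where "k = (p - 1) * j" using assms(2) ..
  moreover have "[(x ^ (p - 1)) ^ j = 1 ^ j] (mod p)"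
    using fermat_theorem[OF assms(1) False] by (rule cong_pow)
  ultimately have "[x ^ k = 1] (mod p)" by (simp add: power_mult)
  from cong_scalar_left[OF this, of x] show ?thesis by simp
qed

text \<open>The prime field of order \<open>p\<close> is a model of the axioms. The only ones that involve the
  exponent are \<open>x * (x * x ^ (M - 1)) = x ^ (M + 1)\<close> and \<open>(x ^ (M - 1)) ^ (M - 1)\<close>, and both
  exponents are \<open>1\<close> modulo \<open>M\<close>, hence modulo \<open>p - 1\<close>.\<close>

lemma residue_sound:
  assumes p: "prime p" "p dvd M" "(p - 1) dvd M" and M: "M \<ge> 2"
  assumes "derivable Md s t"
  shows "[residue M \<rho> s = residue M \<rho> t] (mod p)"
  using assms(5)
proof (induction arbitrary: \<rho>)
  case (ax s t)
  obtain m where m: "M = Suc (Suc m)" using M by (metis add_2_eq_Suc le_Suc_ex)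
  have minus: "[x + (M - 1) * x = 0] (mod p)" for x
  proof -
    have "x + (M - 1) * x = M * x" using m by simp
    then show ?thesis using p(2) by (simp add: cong_0_iff)
  qed
  have "[(x ^ (M - 1)) ^ (M - 1) = x] (mod p)" for x
  proof -
    have "(M - 1) * (M - 1) = Suc (M * m)" using m by (simp add: algebra_simps)
    then have "(x ^ (M - 1)) ^ (M - 1) = x ^ Suc (M * m)"
      by (simp only: power_mult [symmetric])
    moreover have "(p - 1) dvd M * m" using p(3) by simp
    ultimately show ?thesis using fermat_power_cong[OF p(1)] by metis
  qed
  moreover have "[x * (x * x ^ (M - 1)) = x] (mod p)" for x
    using fermat_power_cong[OF p(1) p(3), of x] m by simp
  ultimately show ?case
    using ax minus unfolding Md_def Let_def by (elim insertE) (simp_all add: distrib_left add_ac mult_ac)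
next
  case (inst s t \<sigma>)
  then show ?case by (simp add: residue_subst)
qed (auto intro: cong_sym cong_trans cong_add cong_mult cong_pow)

text \<open>The exponent \<open>m\<close> is large enough because the multiplicity of a prime in \<open>m\<close> is at most \<open>m\<close>.
  This replaces a test for all prime divisors of \<open>m\<close> by one division.\<close>

lemma dvd_power_if_prime_divisors:
  fixes m z :: nat
  assumes "m > 0" and "\<And>p. prime p \<Longrightarrow> p dvd m \<Longrightarrow> p dvd z"
  shows "m dvd z ^ m"
proof (cases "z = 0")
  case False
  show ?thesis
  proof (rule multiplicity_le_imp_dvd)
    fix p :: nat assume p: "prime p"
    show "multiplicity p m \<le> multiplicity p (z ^ m)"
    proof (cases "p dvd m")
      case True
      then have "multiplicity p z \<ge> 1"
        using assms(2) False p by (simp add: Suc_leI prime_multiplicity_gt_zero_iff)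
      have "2 ^ multiplicity p m \<le> p ^ multiplicity p m"
        using p by (simp add: power_mono prime_ge_2_nat)
      also have "\<dots> \<le> m" using assms(1) multiplicity_dvd by (intro dvd_imp_le) auto
      finally have "multiplicity p m \<le> m"
        by (meson le_trans less_exp less_imp_le)
      also have "\<dots> \<le> multiplicity p (z ^ m)"
        using \<open>multiplicity p z \<ge> 1\<close> False p by (simp add: prime_elem_multiplicity_power_distrib)
      finally show ?thesis .
    qed (simp add: not_dvd_imp_multiplicity_0)
  qed (use assms False in auto)
qed (use assms in \<open>simp add: zero_power\<close>)

section \<open>Meadows and their ideals\<close>

class meadow = comm_ring_1 +
  fixes minv :: "'a \<Rightarrow> 'a"
  assumes minv_minv: "minv (minv x) = x"
    and mult_mult_minv: "x * (x * minv x) = x"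

lemma minv_mult_minv: "minv x * (minv x * x) = (minv x :: 'a :: meadow)"
  using mult_mult_minv[of "minv x"] by (simp add: minv_minv)

lemma power_Suc_mult_minv_power: "x ^ Suc n * minv x ^ n = (x :: 'a :: meadow)"
proof (induction n)
  case (Suc n)
  have "x ^ Suc (Suc n) * minv x ^ Suc n = (x ^ Suc n * minv x ^ n) * (x * minv x)"
    by (simp add: mult_ac)
  also have "\<dots> = x" by (simp only: Suc) (rule mult_mult_minv)
  finally show ?case .
qed simp

lemma meadow_reduced:
  assumes "x ^ n = (0 :: 'a :: meadow)"
  shows "x = 0"
  using power_Suc_mult_minv_power[of x n] assms by simp

primrec mval :: "(nat \<Rightarrow> 'a :: meadow) \<Rightarrow> nat mterm \<Rightarrow> 'a" where
  "mval \<rho> (Var x) = \<rho> x"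
| "mval \<rho> Zero = 0"
| "mval \<rho> One = 1"
| "mval \<rho> (Neg t) = - mval \<rho> t"
| "mval \<rho> (Inv t) = minv (mval \<rho> t)"
| "mval \<rho> (Add s t) = mval \<rho> s + mval \<rho> t"
| "mval \<rho> (Mul s t) = mval \<rho> s * mval \<rho> t"

text \<open>On the ideal generated by \<open>f\<close> the integer \<open>M\<close> is zero, so \<open>z\<close> is nilpotent there, hence zero.\<close>

lemma of_nat_annihilates:
  fixes f :: "'a :: meadow"
  assumes "of_nat M * f = 0" and "M dvd z ^ n" and "n > 0"
  shows "of_nat z * f = 0"
proof -
  obtain k where k: "z ^ n = M * k" using assms(2) ..
  have "(of_nat z * f) ^ n = of_nat (z ^ n) * f ^ n"
    by (simp add: power_mult_distrib)
  also have "\<dots> = of_nat k * (of_nat M * f) * f ^ (n - 1)"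
    using assms(3) unfolding k by (cases n) (simp_all add: mult_ac)
  finally show ?thesis using assms(1) meadow_reduced by auto
qed

lemma of_nat_cong_annihilated:
  fixes f :: "'a :: meadow"
  assumes f: "of_nat M * f = 0" and M: "M > 0"
    and eq: "\<And>p. prime p \<Longrightarrow> p dvd M \<Longrightarrow> [m = n] (mod p)"
  shows "of_nat m * f = of_nat n * f"
proof -
  have *: "of_nat i * f = of_nat j * f"
    if "j \<le> i" "\<And>p. prime p \<Longrightarrow> p dvd M \<Longrightarrow> [i = j] (mod p)" for i j
  proof -
    have "p dvd i - j" if "prime p" "p dvd M" for p
      using \<open>j \<le> i\<close> that(1) that(2)
      by (metis \<open>\<And>p. prime p \<Longrightarrow> p dvd M \<Longrightarrow> [i = j] (mod p)\<close> cong_altdef_nat)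
    then have "of_nat (i - j) * f = 0"
      using dvd_power_if_prime_divisors[OF M] of_nat_annihilates[OF f] M by blast
    then show ?thesis using \<open>j \<le> i\<close> by (simp add: of_nat_diff left_diff_distrib)
  qed
  show ?thesis
    using *[of n m, OF _ eq] *[of m n, OF _ cong_sym[OF eq]] by (cases "n \<le> m") simp_all
qed

text \<open>An ideal on which \<open>M\<close> is zero behaves like a product of prime fields with characteristics dividing
  \<open>M\<close>. The substance is the case of inversion: if \<open>x\<close> acts on \<open>f\<close> like an integer, then
  \<open>x ^ (M + 1) = x\<close> holds on \<open>f\<close> by Fermat, and multiplying with the square of \<open>minv x\<close> turns this
  into \<open>x ^ (M - 1) = minv x\<close>.\<close>

lemma mval_eq_residue:
  fixes f :: "'a :: meadow"
  assumes f: "of_nat M * f = 0" and M: "M \<ge> 2"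
    and div: "\<And>p. prime p \<Longrightarrow> p dvd M \<Longrightarrow> (p - 1) dvd M"
    and "closed_term t"
  shows "mval \<rho> t * f = of_nat (residue M \<sigma> t) * f"
  using assms(4)
proof (induction t)
  case (Neg t)
  have "of_nat (M - 1) * f = - f"
    using f M by (simp add: of_nat_diff left_diff_distrib)
  then have "of_nat (residue M \<sigma> (Neg t)) * f = - (of_nat (residue M \<sigma> t) * f)"
    by (simp only: residue.simps of_nat_mult mult.commute[of "of_nat (M - 1)"] mult.assoc mult_minus_right)
  then show ?case using Neg by (simp add: closed_term_def)
next
  case (Inv t)
  define x y n where "x = mval \<rho> t" and "y = minv x" and "n = residue M \<sigma> t"
  have x: "x * f = of_nat n * f" using Inv by (simp add: closed_term_def x_def n_def)
  have pow: "x ^ k * f = of_nat (n ^ k) * f" for k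
  proof (induction k)
    case (Suc k)
    have "x ^ Suc k * f = x * (x ^ k * f)" by (simp add: mult_ac)
    also have "\<dots> = of_nat (n ^ k) * (x * f)" unfolding Suc by (simp only: mult.left_commute)
    also have "\<dots> = of_nat (n ^ Suc k) * f" unfolding x by (simp add: mult_ac)
    finally show ?case .
  qed simp
  have "of_nat (n ^ Suc M) * f = of_nat n * f"
    using M by (intro of_nat_cong_annihilated[OF f] fermat_power_cong div) simp_all
  then have xM: "x ^ Suc M * f = x * f"
    using pow[of "Suc M"] x by simp
  obtain m where m: "M = Suc (Suc m)" using M by (metis add_2_eq_Suc le_Suc_ex)
  have xyx: "x * (x * y) = x" and yxy: "y * (y * x) = y"
    unfolding y_def by (rule mult_mult_minv minv_mult_minv)+
  have "y * f = y * y * (x * f)" using yxy by (simp add: mult_ac)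
  also have "\<dots> = y * y * (x ^ Suc M * f)" by (simp only: xM)
  also have "\<dots> = x ^ m * (x * (x * y)) * (x * y) * f" unfolding m by (simp add: mult_ac)
  also have "\<dots> = x ^ m * (x * (x * y)) * f" unfolding xyx by (simp only: mult.assoc xyx)
  also have "\<dots> = x ^ (M - 1) * f" unfolding xyx m by (simp add: mult_ac)
  finally show ?case unfolding pow by (simp add: x_def y_def n_def)
next
  case (Mul s t)
  then have st: "mval \<rho> s * f = of_nat (residue M \<sigma> s) * f" "mval \<rho> t * f = of_nat (residue M \<sigma> t) * f"
    by (simp_all add: closed_term_def)
  have "mval \<rho> (Mul s t) * f = mval \<rho> s * (mval \<rho> t * f)" by (simp only: mval.simps mult.assoc)
  also have "\<dots> = of_nat (residue M \<sigma> t) * (mval \<rho> s * f)"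
    unfolding st(2) by (rule mult.left_commute)
  finally show ?case unfolding st(1) by (simp add: mult_ac)
qed (simp_all add: closed_term_def distrib_right)

text \<open>The integers from \<open>1\<close> to \<open>h\<close> act as units on the ideal generated by \<open>f\<close>. For
  idempotent \<open>f\<close> that ideal is a ring with unit \<open>f\<close>; equations multiplied by \<open>f\<close> express
  computation in this ring without constructing it.\<close>

definition units_upto :: "nat \<Rightarrow> 'a :: meadow \<Rightarrow> bool" where
  "units_upto h f \<longleftrightarrow> (\<forall>b \<in> {1..h}. \<exists>c. of_nat b * c * f = f)"

lemma units_upto_cancel:
  fixes f :: "'a :: meadow"
  assumes "units_upto h f" and "a \<noteq> 0" "\<bar>a\<bar> \<le> int h" and "of_int a * (x * f) = of_int a * (y * f)"
  shows "x * f = y * f"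
proof -
  obtain c where c: "of_nat (nat \<bar>a\<bar>) * c * f = f"
    using assms(1-3) unfolding units_upto_def by (metis Suc_leI One_nat_def atLeastAtMost_iff nat_le_iff
        zero_less_abs_iff zero_less_nat_eq)
  have a: "of_nat (nat \<bar>a\<bar>) = (of_int (sgn a) * of_int a :: 'a)"
    by (metis abs_ge_zero abs_sgn mult.commute of_int_mult of_int_of_nat_eq nat_0_le)
  have "z * f = of_int (sgn a) * c * (of_int a * (z * f))" for z
  proof -
    have "of_int (sgn a) * c * (of_int a * (z * f)) = z * (of_nat (nat \<bar>a\<bar>) * c * f)"
      unfolding a by (simp only: mult_ac)
    then show ?thesis by (simp only: c)
  qed
  then show ?thesis using assms(4) by metis
qed

section \<open>Closed terms as bounded fractions\<close>

lemma code_less: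
  "code t < code (Neg t)" "code t < code (Inv t)"
  "code s + code t < code (Add s t)" "code s + code t < code (Mul s t)"
proof -
  have "n \<le> triangle n" for n by (induction n) auto
  then have "code s + code t \<le> prod_encode (code s, code t)"
    by (simp add: prod_encode_def trans_le_add1)
  then show "code s + code t < code (Add s t)" "code s + code t < code (Mul s t)" by simp_all
qed simp_all

text \<open>The value of a closed term among the rational numbers, with \<open>0\<close> inverse to itself, as an
  unreduced numerator and denominator. The value at a variable is an arbitrary default.\<close>

primrec fraction :: "nat mterm \<Rightarrow> int \<times> int" where
  "fraction (Var x) = (0, 1)"
| "fraction Zero = (0, 1)"
| "fraction One = (1, 1)"
| "fraction (Neg t) = (case fraction t of (a, b) \<Rightarrow> (- a, b))"
| "fraction (Inv t) = (case fraction t of (a, b) \<Rightarrow> if a = 0 then (0, 1) else (b, a))"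
| "fraction (Add s t) =
     (case fraction s of (a, b) \<Rightarrow> case fraction t of (c, d) \<Rightarrow> (a * d + c * b, b * d))"
| "fraction (Mul s t) =
     (case fraction s of (a, b) \<Rightarrow> case fraction t of (c, d) \<Rightarrow> (a * c, b * d))"

text \<open>Addition at most doubles the product of the bounds for its arguments, and this factor is paid for
  by the code of a sum exceeding the sum of the codes.\<close>

lemma fraction_bound:
  "fraction t = (a, b) \<Longrightarrow> b \<noteq> 0 \<and> \<bar>a\<bar> \<le> 2 ^ code t \<and> \<bar>b\<bar> \<le> 2 ^ code t"
proof (induction t arbitrary: a b)
  case (Neg t)
  obtain c d where cd: "fraction t = (c, d)" by fastforce
  have le: "(2::int) ^ code t \<le> 2 ^ code (Neg t)"
    by (intro power_increasing) simp_all
  have "a = - c" "b = d" using Neg.prems cd by simp_all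
  then show ?case using Neg.IH[OF cd] le by linarith
next
  case (Inv t)
  obtain c d where cd: "fraction t = (c, d)" by fastforce
  have le: "(2::int) ^ code t \<le> 2 ^ code (Inv t)"
    by (intro power_increasing) simp_all
  have "(a, b) = (if c = 0 then (0, 1) else (d, c))" using Inv.prems cd by simp
  then consider "a = 0" "b = 1" | "a = d" "b = c" "c \<noteq> 0" by (auto split: if_splits)
  then show ?case
  proof cases
    case 2
    then show ?thesis using Inv.IH[OF cd] le by linarith
  qed simp
next
  case (Add s t)
  obtain a1 b1 a2 b2 where st: "fraction s = (a1, b1)" "fraction t = (a2, b2)" by fastforce
  have "(2::int) * (2 ^ code s * 2 ^ code t) = 2 ^ Suc (code s + code t)"
    by (simp add: power_add)
  also have "\<dots> \<le> 2 ^ code (Add s t)"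
    using code_less(3)[of s t] by (intro power_increasing) simp_all
  finally have le: "(2::int) * (2 ^ code s * 2 ^ code t) \<le> 2 ^ code (Add s t)" .
  have prod: "\<bar>u * v\<bar> \<le> 2 ^ code s * 2 ^ code t" if "\<bar>u\<bar> \<le> 2 ^ code s" "\<bar>v\<bar> \<le> 2 ^ code t" for u v :: int
    unfolding abs_mult using that by (intro mult_mono) simp_all
  have ab: "a = a1 * b2 + b1 * a2" "b = b1 * b2" using Add.prems st by auto
  show ?case
    using Add.IH(1)[OF st(1)] Add.IH(2)[OF st(2)] prod[of a1 b2] prod[of b1 a2] prod[of b1 b2] le
    unfolding ab by (auto simp del: code.simps)
next
  case (Mul s t)
  obtain a1 b1 a2 b2 where st: "fraction s = (a1, b1)" "fraction t = (a2, b2)" by fastforce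
  have "(2::int) ^ code s * 2 ^ code t = 2 ^ (code s + code t)"
    by (simp add: power_add)
  also have "\<dots> \<le> 2 ^ code (Mul s t)"
    using code_less(4)[of s t] by (intro power_increasing) simp_all
  finally have le: "(2::int) ^ code s * 2 ^ code t \<le> 2 ^ code (Mul s t)" .
  have prod: "\<bar>u * v\<bar> \<le> 2 ^ code s * 2 ^ code t" if "\<bar>u\<bar> \<le> 2 ^ code s" "\<bar>v\<bar> \<le> 2 ^ code t" for u v :: int
    unfolding abs_mult using that by (intro mult_mono) simp_all
  have ab: "a = a1 * a2" "b = b1 * b2" using Mul.prems st by simp_all
  show ?case
    using Mul.IH(1)[OF st(1)] Mul.IH(2)[OF st(2)] prod[of a1 a2] prod[of b1 b2] le
    unfolding ab by (auto simp del: code.simps)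
next
  case (Var x)
  then have "a = 0" "b = 1" by auto
  then show ?case by (simp del: code.simps)
qed auto

text \<open>For an inverse of a term with value \<open>a / b\<close> on \<open>f\<close>, either \<open>a = 0\<close>, in which case the term and
  its inverse vanish on \<open>f\<close>, or \<open>a\<close> is a unit on \<open>f\<close> by its bound, in which case the term is a unit
  there too.\<close>

lemma mval_fraction:
  fixes f :: "'a :: meadow"
  assumes f: "units_upto h f"
  shows "closed_term t \<Longrightarrow> 2 ^ code t \<le> h \<Longrightarrow> fraction t = (a, b) \<Longrightarrow>
    of_int b * (mval \<rho> t * f) = of_int a * f"
proof (induction t arbitrary: a b)
  case (Neg t)
  have "(2::nat) ^ code t \<le> 2 ^ code (Neg t)"
    using code_less(1)[of t] by (intro power_increasing) simp_all
  then have "2 ^ code t \<le> h" using Neg.prems by linarith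
  then show ?case
    using Neg by (auto simp: closed_term_def split: prod.splits)
next
  case (Inv t)
  obtain c d where cd: "fraction t = (c, d)" by fastforce
  have "(2::nat) ^ code t \<le> 2 ^ code (Inv t)"
    using code_less(2)[of t] by (intro power_increasing) simp_all
  then have h: "2 ^ code t \<le> h" using Inv.prems by linarith
  then have "(2::int) ^ code t \<le> int h" by (metis of_nat_le_iff of_nat_numeral of_nat_power)
  then have ch: "\<bar>c\<bar> \<le> int h" and dh: "d \<noteq> 0" "\<bar>d\<bar> \<le> int h"
    using fraction_bound[OF cd] by (auto intro: order_trans simp del: of_nat_power_le_of_nat_cancel_iff)
  define x y where "x = mval \<rho> t" and "y = minv x"
  have dx: "of_int d * (x * f) = of_int c * f"
    unfolding x_def using Inv.IH[OF _ h cd] Inv.prems by (simp add: closed_term_def)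
  show ?case
  proof (cases "c = 0")
    case True
    then have "x * f = 0 * f" using dx by (intro units_upto_cancel[OF f dh]) simp
    moreover have "y * f = y * y * (x * f)"
      using minv_mult_minv[of x] by (simp add: y_def mult_ac)
    ultimately have "y * f = 0" by simp
    then show ?thesis using True Inv.prems cd by (simp add: x_def y_def)
  next
    case False
    have xyx: "x * (x * y) = x" unfolding y_def by (rule mult_mult_minv)
    have "of_int c * (x * y * f) = x * y * (of_int d * (x * f))" unfolding dx by (simp add: mult_ac)
    also have "\<dots> = of_int d * (x * (x * y) * f)" by (simp add: mult_ac)
    also have "\<dots> = of_int c * (1 * f)" unfolding xyx dx by simp
    finally have xy: "x * y * f = 1 * f" by (rule units_upto_cancel[OF f False ch])
    have "of_int c * (y * f) = y * (of_int d * (x * f))" unfolding dx by (simp add: mult_ac)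
    also have "\<dots> = of_int d * (x * y * f)" by (simp add: mult_ac)
    finally show ?thesis unfolding xy using False Inv.prems cd by (simp add: x_def y_def)
  qed
next
  case (Add s t)
  obtain a1 b1 a2 b2 where st: "fraction s = (a1, b1)" "fraction t = (a2, b2)" by fastforce
  have "(2::nat) ^ code s \<le> 2 ^ code (Add s t)" "(2::nat) ^ code t \<le> 2 ^ code (Add s t)"
    using code_less(3)[of s t] by (auto intro!: power_increasing simp del: code.simps)
  then have "2 ^ code s \<le> h" "2 ^ code t \<le> h" using Add.prems by linarith+
  then have e: "of_int b1 * (mval \<rho> s * f) = of_int a1 * f" "of_int b2 * (mval \<rho> t * f) = of_int a2 * f"
    using Add.IH st Add.prems(1) by (simp_all add: closed_term_def)
  have "of_int (b1 * b2) * (mval \<rho> (Add s t) * f) =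
      of_int b2 * (of_int b1 * (mval \<rho> s * f)) + of_int b1 * (of_int b2 * (mval \<rho> t * f))"
    by (simp add: algebra_simps)
  then show ?case
    unfolding e using Add.prems(3) st by (auto simp: algebra_simps)
next
  case (Mul s t)
  obtain a1 b1 a2 b2 where st: "fraction s = (a1, b1)" "fraction t = (a2, b2)" by fastforce
  have "(2::nat) ^ code s \<le> 2 ^ code (Mul s t)" "(2::nat) ^ code t \<le> 2 ^ code (Mul s t)"
    using code_less(4)[of s t] by (auto intro!: power_increasing simp del: code.simps)
  then have "2 ^ code s \<le> h" "2 ^ code t \<le> h" using Mul.prems by linarith+
  then have e: "of_int b1 * (mval \<rho> s * f) = of_int a1 * f" "of_int b2 * (mval \<rho> t * f) = of_int a2 * f"
    using Mul.IH st Mul.prems(1) by (simp_all add: closed_term_def)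
  have "of_int (b1 * b2) * (mval \<rho> (Mul s t) * f) =
      mval \<rho> t * of_int b2 * (of_int b1 * (mval \<rho> s * f))"
    by (simp add: mult_ac)
  also have "\<dots> = of_int a1 * (of_int b2 * (mval \<rho> t * f))"
    unfolding e(1) by (simp only: mult_ac)
  also have "\<dots> = of_int (a1 * a2) * f" unfolding e(2) by (simp add: mult_ac)
  finally show ?case using Mul.prems(3) st by auto
qed (auto simp: closed_term_def)

section \<open>The free meadow\<close>

quotient_type free_meadow = "nat mterm" / "derivable Md"
  by (rule equivpI) (auto simp: reflp_def symp_def transp_def intro: derivable.intros)

lemma Md_instances:
  "derivable Md (Add (Add x y) z) (Add x (Add y z))"
  "derivable Md (Add x y) (Add y x)"
  "derivable Md (Add x Zero) x"
  "derivable Md (Add x (Neg x)) Zero"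
  "derivable Md (Mul (Mul x y) z) (Mul x (Mul y z))"
  "derivable Md (Mul x y) (Mul y x)"
  "derivable Md (Mul x One) x"
  "derivable Md (Mul x (Add y z)) (Add (Mul x y) (Mul x z))"
  "derivable Md (Inv (Inv x)) x"
  "derivable Md (Mul x (Mul x (Inv x))) x"
proof -
  define \<sigma> where "\<sigma> n = (if n = 0 then x else if n = 1 then y else z)" for n :: nat
  have *: "derivable Md (subst \<sigma> (fst e)) (subst \<sigma> (snd e))" if "e \<in> Md" for e
    using that by (intro derivable.inst derivable.ax) simp
  show
    "derivable Md (Add (Add x y) z) (Add x (Add y z))"
    "derivable Md (Add x y) (Add y x)"
    "derivable Md (Add x Zero) x"
    "derivable Md (Add x (Neg x)) Zero"
    "derivable Md (Mul (Mul x y) z) (Mul x (Mul y z))"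
    "derivable Md (Mul x y) (Mul y x)"
    "derivable Md (Mul x One) x"
    "derivable Md (Mul x (Add y z)) (Add (Mul x y) (Mul x z))"
    "derivable Md (Inv (Inv x)) x"
    "derivable Md (Mul x (Mul x (Inv x))) x"
    using *[of "(Add (Add (Var 0) (Var 1)) (Var 2), Add (Var 0) (Add (Var 1) (Var 2)))"]
      *[of "(Add (Var 0) (Var 1), Add (Var 1) (Var 0))"]
      *[of "(Add (Var 0) Zero, Var 0)"]
      *[of "(Add (Var 0) (Neg (Var 0)), Zero)"]
      *[of "(Mul (Mul (Var 0) (Var 1)) (Var 2), Mul (Var 0) (Mul (Var 1) (Var 2)))"]
      *[of "(Mul (Var 0) (Var 1), Mul (Var 1) (Var 0))"]
      *[of "(Mul (Var 0) One, Var 0)"]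
      *[of "(Mul (Var 0) (Add (Var 1) (Var 2)), Add (Mul (Var 0) (Var 1)) (Mul (Var 0) (Var 2)))"]
      *[of "(Inv (Inv (Var 0)), Var 0)"]
      *[of "(Mul (Var 0) (Mul (Var 0) (Inv (Var 0))), Var 0)"]
    by (force simp: Md_def Let_def \<sigma>_def)+
qed

lemma not_derivable_Zero_One: "\<not> derivable Md Zero One"
  using residue_sound[of 2 2 Zero One] by (auto simp: cong_def)

instantiation free_meadow :: meadow
begin

lift_definition zero_free_meadow :: free_meadow is Zero .
lift_definition one_free_meadow :: free_meadow is One .
lift_definition uminus_free_meadow :: "free_meadow \<Rightarrow> free_meadow" is Neg by (rule derivable.neg)
lift_definition minv_free_meadow :: "free_meadow \<Rightarrow> free_meadow" is Inv by (rule derivable.inv)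
lift_definition plus_free_meadow :: "free_meadow \<Rightarrow> free_meadow \<Rightarrow> free_meadow" is Add
  by (rule derivable.add)
lift_definition times_free_meadow :: "free_meadow \<Rightarrow> free_meadow \<Rightarrow> free_meadow" is Mul
  by (rule derivable.mul)
definition minus_free_meadow :: "free_meadow \<Rightarrow> free_meadow \<Rightarrow> free_meadow" where
  "minus_free_meadow x y = x + - y"

instance
proof
  fix x y z :: free_meadow
  show "x + y + z = x + (y + z)" by transfer (rule Md_instances)
  show comm: "x + y = y + x" for x y :: free_meadow by transfer (rule Md_instances)
  show "0 + x = x" unfolding comm[of 0] by transfer (rule Md_instances)
  show "- x + x = 0" unfolding comm[of "- x"] by transfer (rule Md_instances)
  show "x - y = x + - y" by (rule minus_free_meadow_def)
  show "x * y * z = x * (y * z)" by transfer (rule Md_instances)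
  show mcomm: "x * y = y * x" for x y :: free_meadow by transfer (rule Md_instances)
  show "1 * x = x" unfolding mcomm[of 1] by transfer (rule Md_instances)
  have "x * (y + z) = x * y + x * z" for x y z :: free_meadow by transfer (rule Md_instances)
  then show "(x + y) * z = x * z + y * z" by (metis mcomm)
  show "(0 :: free_meadow) \<noteq> 1" by transfer (rule not_derivable_Zero_One)
  show "minv (minv x) = x" by transfer (rule Md_instances)
  show "x * (x * minv x) = x" by transfer (rule Md_instances)
qed

end

lemma abs_free_meadow_mval: "abs_free_meadow t = mval (\<lambda>x. abs_free_meadow (Var x)) t"
  by (induction t)
    (simp_all add: zero_free_meadow_def one_free_meadow_def flip: uminus_free_meadow.abs_eq
      minv_free_meadow.abs_eq plus_free_meadow.abs_eq times_free_meadow.abs_eq)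

text \<open>The free meadow satisfies exactly the provable equations, so provability can be established by
  computing in a ring.\<close>

lemma derivable_iff_mval_eq:
  "derivable Md s t \<longleftrightarrow>
     mval (\<lambda>x. abs_free_meadow (Var x)) s = mval (\<lambda>x. abs_free_meadow (Var x)) t"
  by (simp flip: abs_free_meadow_mval add: free_meadow.abs_eq_iff)

primrec numeral_term :: "nat \<Rightarrow> nat mterm" where
  "numeral_term 0 = Zero"
| "numeral_term (Suc n) = Add One (numeral_term n)"

lemma mval_numeral_term: "mval \<rho> (numeral_term n) = of_nat n"
  by (induction n) simp_all

lemma residue_numeral_term: "residue M \<rho> (numeral_term n) = n"
  by (induction n) simp_all

lemma prime_diff_1_dvd_fact:
  fixes p :: nat
  assumes "prime p" "p dvd fact n"
  shows "(p - 1) dvd fact n"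
  using assms prime_dvd_fact_iff[of p n] prime_gt_1_nat[of p] by (intro dvd_fact) auto

text \<open>In the prime field of a prime factor of \<open>n\<close> the number \<open>n\<close> is zero, and soundness transfers this to
  provable equations.\<close>

lemma of_nat_not_unit_free_meadow:
  assumes "n > 1"
  shows "of_nat n * minv (of_nat n) \<noteq> (1 :: free_meadow)"
proof
  assume *: "of_nat n * minv (of_nat n) = (1 :: free_meadow)"
  let ?n = "numeral_term n"
  have "derivable Md (Mul ?n (Inv ?n)) One"
    using * by (simp add: derivable_iff_mval_eq mval_numeral_term)
  moreover obtain p where p: "prime p" "p dvd n"
    using assms prime_factor_nat[of n] by auto
  have n: "p \<le> n" using p assms by (auto intro: dvd_imp_le)
  then have dvd: "p dvd fact n" using p by (simp add: prime_dvd_fact_iff)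
  moreover have "(2::nat) \<le> fact n" using assms fact_ge_self[of n] by linarith
  ultimately have "[residue (fact n) (\<lambda>_. 0) (Mul ?n (Inv ?n)) = residue (fact n) (\<lambda>_. 0) One] (mod p)"
    using p by (intro residue_sound prime_diff_1_dvd_fact)
  then have "[n * n ^ (fact n - 1) = 1] (mod p)" by (simp add: residue_numeral_term)
  moreover have "[n * n ^ (fact n - 1) = 0] (mod p)" using p(2) by (simp add: cong_0_iff)
  ultimately have "p dvd 1" by (metis cong_0_iff cong_sym cong_trans)
  then show False using p(1) by simp
qed

section \<open>The divisibility test\<close>

text \<open>With \<open>h = 2 ^ c\<close>, this is a multiple of all positive integers up to \<open>h\<close> and of \<open>h! + 1\<close>, and \<open>p - 1\<close>
  divides it for all its prime divisors \<open>p\<close>.\<close>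

definition test_modulus :: "nat \<Rightarrow> nat" where
  "test_modulus c = fact (Suc (fact (2 ^ c)))"

definition passes_zero_test :: "nat mterm \<Rightarrow> bool" where
  "passes_zero_test t \<longleftrightarrow>
     (let M = test_modulus (code t) in M dvd residue M (\<lambda>_. 0) t ^ M)"

lemma test_modulus_ge_2: "test_modulus c \<ge> 2"
proof -
  have "(2::nat) \<le> Suc (fact (2 ^ c))" using fact_ge_1[where 'a = nat, of "2 ^ c"] by simp
  also have "\<dots> \<le> fact (Suc (fact (2 ^ c)))" by (rule fact_ge_self)
  finally show ?thesis by (simp only: test_modulus_def)
qed

lemma passes_zero_test_if_derivable:
  assumes "derivable Md t Zero"
  shows "passes_zero_test t"
proof -
  define M where "M = test_modulus (code t)"
  have M: "M \<ge> 2" unfolding M_def by (rule test_modulus_ge_2)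
  have "p dvd residue M (\<lambda>_. 0) t" if p: "prime p" "p dvd M" for p
  proof -
    have "(p - 1) dvd M" using p unfolding M_def test_modulus_def by (rule prime_diff_1_dvd_fact)
    from residue_sound[OF p this M assms] show ?thesis by (simp add: cong_0_iff)
  qed
  then show ?thesis
    unfolding passes_zero_test_def Let_def M_def[symmetric]
    using M by (intro dvd_power_if_prime_divisors) auto
qed

lemma units_upto_idem:
  assumes "\<And>b. b \<in> {1..h} \<Longrightarrow> b dvd m"
  shows "units_upto h (of_nat m * minv (of_nat m) :: 'a :: meadow)"
  unfolding units_upto_def
proof
  fix b assume "b \<in> {1..h}"
  then obtain k where k: "m = b * k" using assms by blast
  define x where "x = (of_nat m :: 'a)"
  have "of_nat b * (of_nat k * minv x) * (x * minv x) = x * (x * minv x) * minv x"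
    unfolding x_def k by (simp add: mult_ac)
  also have "\<dots> = x * minv x" by (simp only: mult_mult_minv)
  finally show "\<exists>c. of_nat b * c * (of_nat m * minv (of_nat m)) = (of_nat m * minv (of_nat m) :: 'a)"
    unfolding x_def by blast
qed

text \<open>Where \<open>h! + 1\<close> is zero, \<open>h!\<close> is \<open>-1\<close>, so its divisors are units. The number \<open>h! + 1\<close> serves
  instead of a prime above \<open>h\<close>.\<close>

lemma units_upto_Suc_fact_annihilated:
  fixes f :: "'a :: meadow"
  assumes "of_nat (Suc (fact h)) * f = 0"
  shows "units_upto h f"
  unfolding units_upto_def
proof
  fix b assume "b \<in> {1..h}"
  then have "b dvd fact h" by (intro dvd_fact) auto
  then obtain k where k: "fact h = b * k" ..
  have "of_nat b * (- of_nat k) * f = - (of_nat (fact h) * f)"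
    unfolding k by (simp add: mult_ac)
  also have "\<dots> = f"
    using assms minus_unique[of "of_nat (fact h) * f" f] by (simp add: distrib_right add.commute)
  finally show "\<exists>c. of_nat b * c * f = f" by blast
qed

lemma annihilator_idem: "x * (1 - x * minv x) = (0 :: 'a :: meadow)"
  by (simp add: right_diff_distrib mult_mult_minv)

text \<open>The value \<open>u\<close> of the term in the free meadow is shown to vanish both where \<open>M\<close> is zero and where it
  is a unit. In the second part \<open>u\<close> is the fraction \<open>a / b\<close>, and \<open>a = 0\<close> is read off a nonzero ideal
  contained in the first part on which the integers up to \<open>h\<close> are units as well.\<close>

lemma derivable_if_passes_zero_test:
  assumes "closed_term t" "passes_zero_test t"
  shows "derivable Md t Zero"
proof -
  define h :: nat where "h = 2 ^ code t"
  define q :: nat where "q = Suc (fact h)"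
  define M :: nat where "M = fact q"
  have M_eq: "test_modulus (code t) = M"
    by (simp only: M_def q_def h_def test_modulus_def)
  have M: "M \<ge> 2" using test_modulus_ge_2 M_eq by metis
  define r where "r = residue M (\<lambda>_. 0) t"
  have r: "M dvd r ^ M"
    using assms(2) unfolding passes_zero_test_def M_eq r_def Let_def .
  define u where "u = mval (\<lambda>x. abs_free_meadow (Var x)) t"
  have finite_part: "u * f = 0" if f: "of_nat M * f = 0" for f
  proof -
    have "u * f = of_nat r * f"
      unfolding u_def r_def using M assms(1)
      by (intro mval_eq_residue[OF f]) (auto simp: M_def intro: prime_diff_1_dvd_fact[unfolded One_nat_def])
    also have "\<dots> = 0" using M by (intro of_nat_annihilates[OF f r]) simp
    finally show ?thesis .
  qed
  obtain a b where ab: "fraction t = (a, b)" by fastforce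
  have "int h = 2 ^ code t" by (simp add: h_def)
  with fraction_bound[OF ab] have a: "\<bar>a\<bar> \<le> int h" and b: "b \<noteq> 0" "\<bar>b\<bar> \<le> int h"
    by simp_all
  have rational_part: "of_int b * (u * f) = of_int a * f" if "units_upto h f" for f
    unfolding u_def using mval_fraction[OF that assms(1) _ ab] by (simp add: h_def)
  have "a = 0"
  proof (rule ccontr)
    assume "a \<noteq> 0"
    \<comment> \<open>the idempotent that cuts out the part where \<open>q\<close> is zero\<close>
    define f :: free_meadow where "f = 1 - of_nat q * minv (of_nat q)"
    have qf: "of_nat q * f = 0" unfolding f_def by (rule annihilator_idem)
    then have f: "units_upto h f" unfolding q_def by (rule units_upto_Suc_fact_annihilated)
    have "q dvd M" unfolding M_def by (intro dvd_fact) (simp_all add: q_def)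
    then obtain k where "M = q * k" ..
    then have "of_nat M * f = of_nat k * (of_nat q * f)" by (simp add: mult_ac)
    then have "u * f = 0" using qf by (intro finite_part) simp
    then have "of_int a * (1 * f) = of_int a * (0 * f)" using rational_part[OF f] by simp
    then have "f = 0" using units_upto_cancel[OF f \<open>a \<noteq> 0\<close> a, of 1 0] by simp
    moreover have "q > 1" by (simp add: q_def)
    ultimately show False using of_nat_not_unit_free_meadow[of q] by (simp add: f_def)
  qed
  \<comment> \<open>the idempotent that cuts out the part where \<open>M\<close> is a unit\<close>
  define e :: free_meadow where "e = of_nat M * minv (of_nat M)"
  have "h \<le> q" using fact_ge_self[of h] by (simp add: q_def)
  then have e: "units_upto h e"
    unfolding e_def M_def by (intro units_upto_idem dvd_fact) auto
  have "of_int b * (u * e) = of_int b * (0 * e)"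
    using rational_part[OF e] \<open>a = 0\<close> by simp
  then have "u * e = 0 * e" by (rule units_upto_cancel[OF e b])
  then have "u * (of_nat M * minv (of_nat M)) = 0" by (simp add: e_def)
  moreover have "u * (1 - of_nat M * minv (of_nat M)) = 0"
    by (intro finite_part annihilator_idem)
  ultimately have "u = 0" by (simp add: right_diff_distrib)
  then show ?thesis by (simp add: derivable_iff_mval_eq u_def)
qed

section \<open>The test is recursive\<close>

definition residue_of_code :: "nat \<Rightarrow> nat \<Rightarrow> nat" where
  "residue_of_code M n = residue M (\<lambda>_. 0) (the_inv code n)"

lemma residue_of_code [simp]: "residue_of_code M (code t) = residue M (\<lambda>_. 0) t"
  using bij_code by (simp add: residue_of_code_def the_inv_f_f bij_is_inj)

text \<open>The remainder modulo 5 identifies the top symbol. Sums and products have codes \<open>5 * m + 5\<close> and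
  \<open>5 * m + 6\<close> for the pair \<open>m\<close> of argument codes, hence the correction by one after the division.\<close>

definition residue_step :: "nat \<Rightarrow> nat \<Rightarrow> nat \<Rightarrow> nat" where
  "residue_step M n H =
    (if n \<le> 1 then n
     else if n mod 5 = 0 then
       recall n H (fst (prod_decode (n div 5 - 1))) + recall n H (snd (prod_decode (n div 5 - 1)))
     else if n mod 5 = 1 then
       recall n H (fst (prod_decode (n div 5 - 1))) * recall n H (snd (prod_decode (n div 5 - 1)))
     else if n mod 5 = 2 then 0
     else if n mod 5 = 3 then (M - 1) * recall n H (n div 5)
     else recall n H (n div 5) ^ (M - 1))"

lemma residue_of_code_step:
  "residue_of_code M n = residue_step M n (history (residue_of_code M) n)"
proof -
  obtain t where n: "n = code t" using bij_code by (metis bij_pointE)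
  have call: "recall n (history (residue_of_code M) n) (code s) = residue M (\<lambda>_. 0) s"
    if "code s < n" for s
    using recall_history[OF that, of "residue_of_code M"] by simp
  have val: "residue_of_code M n = residue M (\<lambda>_. 0) t" unfolding n by (rule residue_of_code)
  show ?thesis
  proof (cases t)
    case (Neg s)
    then have "n mod 5 = 3" "n div 5 = code s" "\<not> n \<le> 1" unfolding n by simp_all
    moreover have "code s < n" using code_less(1) n Neg by metis
    ultimately show ?thesis using Neg by (simp add: val residue_step_def call)
  next
    case (Inv s)
    then have "n mod 5 = 4" "n div 5 = code s" "\<not> n \<le> 1" unfolding n by simp_all
    moreover have "code s < n" using code_less(2) n Inv by metis
    ultimately show ?thesis using Inv by (simp add: val residue_step_def call)
  next
    case (Add s1 s2)
    then have "n mod 5 = 0" "n div 5 - 1 = prod_encode (code s1, code s2)" "\<not> n \<le> 1" unfolding n by simp_all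
    moreover have "code s1 < n" "code s2 < n" using code_less(3)[of s1 s2] unfolding n Add by linarith+
    ultimately show ?thesis using Add by (simp add: val residue_step_def call)
  next
    case (Mul s1 s2)
    then have "n mod 5 = 1" "n div 5 - 1 = prod_encode (code s1, code s2)" "\<not> n \<le> 1" unfolding n by simp_all
    moreover have "code s1 < n" "code s2 < n" using code_less(4)[of s1 s2] unfolding n Mul by linarith+
    ultimately show ?thesis using Mul by (simp add: val residue_step_def call)
  next
    case (Var x)
    then have "n mod 5 = 2" "\<not> n \<le> 1" unfolding n by (simp_all, presburger)
    then show ?thesis using Var by (simp add: val residue_step_def)
  next
    case Zero
    then show ?thesis using val by (simp add: n residue_step_def)
  next
    case One
    then show ?thesis using val by (simp add: n residue_step_def)
  qed
qed

lemma total_rec_residue_of_code [recursive]: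
  assumes "total_rec k A" "total_rec k N"
  shows "total_rec k (\<lambda>xs. residue_of_code (A xs) (N xs))"
proof (rule total_rec_course_of_values[where G = residue_step, OF _ residue_of_code_step assms])
  show "total_rec 3 (\<lambda>ys. residue_step (ys ! 0) (ys ! 1) (ys ! 2))"
    unfolding residue_step_def by (intro recursive) simp_all
qed

theorem corollary3p17:
  "\<exists>f. \<forall>s t :: nat mterm. closed_term s \<longrightarrow> closed_term t \<longrightarrow>
     eval f [code s, code t] = Some (if derivable Md s t then 1 else 0)"
proof -
  \<comment> \<open>the code of \<open>s - t\<close>, computed from the codes of \<open>s\<close> and \<open>t\<close>\<close>
  define c where "c xs = 5 * prod_encode (xs ! 0, 5 * xs ! 1 + 3) + 5" for xs
  define M where "M xs = test_modulus (c xs)" for xs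
  have c: "total_rec 2 c"
    unfolding c_def by (intro recursive) simp_all
  have M: "total_rec 2 M"
    unfolding M_def test_modulus_def by (intro recursive c)
  define D where
    "D xs = (if residue_of_code (M xs) (c xs) ^ M xs mod M xs = 0 then 1 else 0 :: nat)" for xs
  have "total_rec 2 D"
    unfolding D_def by (intro recursive M c)
  then obtain f where f: "\<forall>xs. length xs = 2 \<longrightarrow> eval f xs = Some (D xs)"
    by (auto simp: total_rec_def)
  have "eval f [code s, code t] = Some (if derivable Md s t then 1 else 0)"
    if st: "closed_term s" "closed_term t" for s t
  proof -
    have c_eq: "c [code s, code t] = code (Add s (Neg t))" by (simp add: c_def)
    have closed: "closed_term (Add s (Neg t))" using st by (simp add: closed_term_def)
    have "D [code s, code t] = (if passes_zero_test (Add s (Neg t)) then 1 else 0)"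
      unfolding D_def M_def c_eq residue_of_code passes_zero_test_def Let_def dvd_eq_mod_eq_0 ..
    moreover have "passes_zero_test (Add s (Neg t)) \<longleftrightarrow> derivable Md (Add s (Neg t)) Zero"
      using passes_zero_test_if_derivable derivable_if_passes_zero_test[OF closed] by blast
    moreover have "derivable Md (Add s (Neg t)) Zero \<longleftrightarrow> derivable Md s t"
      by (simp add: derivable_iff_mval_eq)
    ultimately show ?thesis using f by simp
  qed
  then show ?thesis by blast
qed

end
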